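(* Given any directed signed graph $G(V,E)$ and any labeling $\boldsymbol{y}\in\{-1,+1\}^{E}$, the expected number of mistakes made by the algorithm $\mathrm{ALCONE}$ satisfies $$\mathbb{E}\, m_{\mathrm{ALCONE}} \le 2\,\Psi(\boldsymbol{y}),$$ while the number of distinct labels queried by $\mathrm{ALCONE}$ is not larger than $|V|$.
   Context: $G(V,E)$ is a finite directed graph; each edge $i\to j\in E$ carries a label $y_{i\to j}\in\{-1,+1\}$, and $\boldsymbol{y}=(y_{i\to j})_{i\to j\in E}$ is the labeling, fixed before the algorithm runs. For a node $i$, $E_{\mathrm{out}}(i)$ is the set of edges outgoing from $i$, and $d^+_{\mathrm{out}}(i)$, $d^-_{\mathrm{out}}(i)$ are the numbers of edges in $E_{\mathrm{out}}(i)$ labeled $+1$ and $-1$ respectively. The labeling irregularity is $$\Psi(\boldsymbol{y})=\sum_{i\in V}\min\bigl(d^+_{\mathrm{out}}(i),d^-_{\mathrm{out}}(i)\bigr).$$ Algorithm $\mathrm{ALCONE}$ (version using outgoing edges): in the selection phase, for each node $i\in V$ with $E_{\mathrm{out}}(i)\neq\emptyset$, it picks one edge uniformly at random in $E_{\mathrm{out}}(i)$ (independently over nodes) and queries its label. In the prediction phase, for each node $i$, every non-queried edge in $E_{\mathrm{out}}(i)$ is predicted with the label observed on the queried edge of $E_{\mathrm{out}}(i)$. The number of mistakes $m_{\mathrm{ALCONE}}$ is the number of non-queried edges whose predicted label differs from the true label; the expectation is over the random choice of the queried edges. *)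

theory Defs
  imports "HOL-Probability.Product_PMF" "Graph_Theory.Pair_Digraph"
begin

text \<open>
  A directed graph is a \<^typ>\<open>'a pair_pre_digraph\<close>, so that an edge from \<open>i\<close> to \<open>j\<close> is the
  pair \<open>(i, j)\<close>; there are no parallel edges, but antiparallel edges and self-loops are allowed.
  A labeling is a function on pairs, of which only the values on the edges matter.
\<close>

definition signed_labeling :: "'a pair_pre_digraph \<Rightarrow> ('a \<times> 'a \<Rightarrow> int) \<Rightarrow> bool" where
  "signed_labeling G y \<longleftrightarrow> (\<forall>e \<in> parcs G. y e \<in> {-1, 1})"

definition pos_out_degree :: "'a pair_pre_digraph \<Rightarrow> ('a \<times> 'a \<Rightarrow> int) \<Rightarrow> 'a \<Rightarrow> nat" where
  "pos_out_degree G y i = card {e \<in> out_arcs G i. y e = 1}"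

definition neg_out_degree :: "'a pair_pre_digraph \<Rightarrow> ('a \<times> 'a \<Rightarrow> int) \<Rightarrow> 'a \<Rightarrow> nat" where
  "neg_out_degree G y i = card {e \<in> out_arcs G i. y e = -1}"

definition irregularity :: "'a pair_pre_digraph \<Rightarrow> ('a \<times> 'a \<Rightarrow> int) \<Rightarrow> nat" where
  "irregularity G y = (\<Sum>i \<in> pverts G. min (pos_out_degree G y i) (neg_out_degree G y i))"

definition nonsink_nodes :: "'a pair_pre_digraph \<Rightarrow> 'a set" where
  "nonsink_nodes G = {i \<in> pverts G. out_arcs G i \<noteq> {}}"

text \<open>
  An outcome of the selection phase is a function \<open>s\<close> mapping each node with an outgoing edge to
  the edge queried there; on all other nodes \<open>s\<close> has a dummy value that is never used.
\<close>

definition alcone_selection :: "'a pair_pre_digraph \<Rightarrow> ('a \<Rightarrow> 'a \<times> 'a) pmf" where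
  "alcone_selection G =
     Pi_pmf (nonsink_nodes G) undefined (\<lambda>i. pmf_of_set (out_arcs G i))"

definition queried_edges :: "'a pair_pre_digraph \<Rightarrow> ('a \<Rightarrow> 'a \<times> 'a) \<Rightarrow> ('a \<times> 'a) set" where
  "queried_edges G s = s ` nonsink_nodes G"

definition alcone_prediction ::
    "('a \<times> 'a \<Rightarrow> int) \<Rightarrow> ('a \<Rightarrow> 'a \<times> 'a) \<Rightarrow> 'a \<times> 'a \<Rightarrow> int" where
  "alcone_prediction y s e = y (s (fst e))"

definition alcone_mistakes ::
    "'a pair_pre_digraph \<Rightarrow> ('a \<times> 'a \<Rightarrow> int) \<Rightarrow> ('a \<Rightarrow> 'a \<times> 'a) \<Rightarrow> nat" where
  "alcone_mistakes G y s =
     card {e \<in> parcs G - queried_edges G s. alcone_prediction y s e \<noteq> y e}"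

end

theory Submission
  imports Defs
begin

text \<open>
  By linearity of expectation it suffices to treat each node separately. At a node with \<open>p\<close> positive
  and \<open>n\<close> negative outgoing edges, querying a positive edge costs \<open>n\<close> mistakes and querying a
  negative one costs \<open>p\<close>, so the expected cost is \<open>2 p n / (p + n) \<le> 2 min p n\<close>.
\<close>

lemma expectation_disagreements_le:
  fixes y :: "'b \<Rightarrow> int"
  assumes "finite A" and "A \<noteq> {}" and signed: "\<forall>e\<in>A. y e \<in> {-1, 1}"
  shows "measure_pmf.expectation (pmf_of_set A) (\<lambda>a. real (card {e \<in> A. y a \<noteq> y e}))
           \<le> 2 * real (min (card {e \<in> A. y e = 1}) (card {e \<in> A. y e = -1}))"
proof -
  define P where "P = {e \<in> A. y e = 1}"
  define N where "N = {e \<in> A. y e = -1}"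
  have A: "A = P \<union> N" and disj: "P \<inter> N = {}" and fin: "finite P" "finite N"
    using assms by (auto simp: P_def N_def)
  have disagree_P: "{e \<in> A. y a \<noteq> y e} = N" if "a \<in> P" for a
    using that signed by (auto simp: P_def N_def)
  have disagree_N: "{e \<in> A. y a \<noteq> y e} = P" if "a \<in> N" for a
    using that signed by (auto simp: P_def N_def)
  have "(\<Sum>a\<in>A. real (card {e \<in> A. y a \<noteq> y e}))
      = (\<Sum>a\<in>P. real (card {e \<in> A. y a \<noteq> y e})) + (\<Sum>a\<in>N. real (card {e \<in> A. y a \<noteq> y e}))"
    \<comment> \<open>Only the index set is split; the \<open>A\<close> inside the counted set
      stays, so that \<open>disagree_P\<close> and \<open>disagree_N\<close> apply to the
      summands.\<close>
    by (subst (1) A) (rule sum.union_disjoint[OF fin disj])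
  also have "\<dots> = 2 * (real (card P) * real (card N))"
    by (simp add: disagree_P disagree_N)
  finally have total:
    "(\<Sum>a\<in>A. real (card {e \<in> A. y a \<noteq> y e})) = 2 * (real (card P) * real (card N))" .
  have card_A: "card A = card P + card N"
    unfolding A using fin disj by (rule card_Un_disjoint)
  \<comment> \<open>The product equals minimum times maximum, and the maximum is at most the sum
    \<open>card A\<close>.\<close>
  have "card P * card N \<le> min (card P) (card N) * card A"
    by (simp add: card_A min_def algebra_simps)
  then have "2 * (real (card P) * real (card N)) \<le> 2 * real (min (card P) (card N)) * real (card A)"
    by (metis mult.assoc mult_le_cancel_left_pos of_nat_le_iff of_nat_mult zero_less_numeral)
  \<comment> \<open>The expectation is the total divided by \<open>card A\<close>; positivity allows
    this denominator to be cleared.\<close>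
  moreover have "0 < real (card A)"
    using assms by (simp add: card_gt_0_iff)
  ultimately show ?thesis
    using assms total by (simp add: integral_pmf_of_set divide_le_eq flip: P_def N_def)
qed

text \<open>The marginal of the product distribution at \<open>i\<close> is \<open>p i\<close>. This
  reduces the cost at one node to a single uniform draw from its outgoing edges.\<close>

lemma expectation_Pi_pmf_component:
  fixes f :: "'b \<Rightarrow> real"
  assumes "finite I" and "i \<in> I"
  shows "measure_pmf.expectation (Pi_pmf I d p) (\<lambda>s. f (s i)) = measure_pmf.expectation (p i) f"
proof -
  have "measure_pmf.expectation (p i) f
      = measure_pmf.expectation (map_pmf (\<lambda>s. s i) (Pi_pmf I d p)) f"
    using assms by (simp add: Pi_pmf_component)
  then show ?thesis
    by simp
qed

text \<open>Each mistaken edge is charged to its tail, which has an outgoing edge. Queried edges may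
  stay in the counts on the right: if \<open>s i\<close> leaves \<open>i\<close>, it agrees with its
  own label. The bound is pointwise in \<open>s\<close>, ready for monotonicity of the
  integral.\<close>

lemma alcone_mistakes_le:
  assumes "pair_fin_digraph G"
  shows "alcone_mistakes G y s
           \<le> (\<Sum>i\<in>nonsink_nodes G. card {e \<in> out_arcs G i. y (s i) \<noteq> y e})"
proof -
  interpret pair_fin_digraph G by fact
  have fin: "finite (nonsink_nodes G)"
    by (simp add: nonsink_nodes_def)
  have "{e \<in> parcs G - queried_edges G s. alcone_prediction y s e \<noteq> y e}
      \<subseteq> (\<Union>i\<in>nonsink_nodes G. {e \<in> out_arcs G i. y (s i) \<noteq> y e})"
    by (auto simp: alcone_prediction_def nonsink_nodes_def out_arcs_def dest: in_arcsD1)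
  then have "alcone_mistakes G y s
      \<le> card (\<Union>i\<in>nonsink_nodes G. {e \<in> out_arcs G i. y (s i) \<noteq> y e})"
    unfolding alcone_mistakes_def using fin by (intro card_mono) auto
  also have "\<dots> \<le> (\<Sum>i\<in>nonsink_nodes G. card {e \<in> out_arcs G i. y (s i) \<noteq> y e})"
    by (rule card_UN_le[OF fin])
  finally show ?thesis .
qed

text \<open>Finite support makes every real function of the selection integrable, which monotonicity
  and linearity of the expectation require.\<close>

lemma finite_set_pmf_alcone_selection:
  assumes "pair_fin_digraph G"
  shows "finite (set_pmf (alcone_selection G))"
proof -
  interpret pair_fin_digraph G by fact
  have "finite (nonsink_nodes G)"
    by (simp add: nonsink_nodes_def)
  \<comment> \<open>\<open>pmf_of_set\<close> is the uniform distribution only on a finite nonempty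
    set; the choice of index set guarantees nonemptiness.\<close>
  moreover have "set_pmf (pmf_of_set (out_arcs G i)) = out_arcs G i" if "i \<in> nonsink_nodes G" for i
    using that finite_out_arcs by (simp add: nonsink_nodes_def)
  ultimately show ?thesis
    by (auto simp: alcone_selection_def set_Pi_pmf intro!: finite_PiE_dflt)
qed

theorem theorem2:
  fixes G :: "'a pair_pre_digraph" and y :: "'a \<times> 'a \<Rightarrow> int"
  assumes "pair_fin_digraph G"
    and "signed_labeling G y"
  shows "measure_pmf.expectation (alcone_selection G) (\<lambda>s. real (alcone_mistakes G y s))
           \<le> 2 * real (irregularity G y)
         \<and> (\<forall>s \<in> set_pmf (alcone_selection G). card (queried_edges G s) \<le> card (pverts G))"
proof
  interpret pair_fin_digraph G by fact
  let ?M = "alcone_selection G"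
  let ?I = "nonsink_nodes G"
  have fin: "finite ?I" and sub: "?I \<subseteq> pverts G"
    by (auto simp: nonsink_nodes_def)
  have integrable: "integrable ?M f" for f :: "_ \<Rightarrow> real"
    by (intro integrable_measure_pmf_finite finite_set_pmf_alcone_selection assms)
  let ?c = "\<lambda>i e'. real (card {e \<in> out_arcs G i. y e' \<noteq> y e})"
  let ?m = "\<lambda>i. min (pos_out_degree G y i) (neg_out_degree G y i)"
  have "measure_pmf.expectation ?M (\<lambda>s. real (alcone_mistakes G y s))
      \<le> measure_pmf.expectation ?M (\<lambda>s. \<Sum>i\<in>?I. ?c i (s i))"
    using alcone_mistakes_le[OF assms(1)]
    by (intro integral_mono integrable) (simp flip: of_nat_sum)
  also have "\<dots> = (\<Sum>i\<in>?I. measure_pmf.expectation ?M (\<lambda>s. ?c i (s i)))"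
    by (intro Bochner_Integration.integral_sum integrable)
  also have "\<dots> = (\<Sum>i\<in>?I. measure_pmf.expectation (pmf_of_set (out_arcs G i)) (?c i))"
    unfolding alcone_selection_def using fin
    by (intro sum.cong refl expectation_Pi_pmf_component)
  also have "\<dots> \<le> (\<Sum>i\<in>?I. 2 * real (?m i))"
    unfolding pos_out_degree_def neg_out_degree_def
  proof (intro sum_mono expectation_disagreements_le)
    fix i assume "i \<in> ?I"
    then show "out_arcs G i \<noteq> {}"
      by (simp add: nonsink_nodes_def)
    show "finite (out_arcs G i)"
      by (rule finite_out_arcs)
    show "\<forall>e\<in>out_arcs G i. y e \<in> {-1, 1}"
      using assms(2) by (auto simp: signed_labeling_def)
  qed
  \<comment> \<open>The nodes added here have no outgoing edges, so their terms are zero.\<close>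
  also have "\<dots> \<le> (\<Sum>i\<in>pverts G. 2 * real (?m i))"
    using sub by (intro sum_mono2) auto
  also have "\<dots> = 2 * real (irregularity G y)"
    by (simp add: irregularity_def sum_distrib_left)
  finally show "measure_pmf.expectation ?M (\<lambda>s. real (alcone_mistakes G y s))
      \<le> 2 * real (irregularity G y)" .
  show "\<forall>s\<in>set_pmf ?M. card (queried_edges G s) \<le> card (pverts G)"
    \<comment> \<open>The queried edges are the image under \<open>s\<close> of a subset of the
      nodes, and an image is no larger than its domain.\<close>
    unfolding queried_edges_def
    using card_image_le[OF fin] card_mono[OF _ sub] by (auto intro: order_trans)
qed

end
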